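(* Let $t_0<T$ be real numbers, $K>0$, $u_0\in\mathbb{R}\setminus\{0\}$, $z_0,z_T\in\mathbb{R}^2$, and let the Lagrangian be $$\mathcal{L}(z,a)=\tfrac12 K\|a\|^2-\tfrac12 u_0\|z\|^2,\qquad z,a\in\mathbb{R}^2 .$$ Consider the problem $$S(t_0,z_0,T,z_T)=\min_{a\in\Omega(t_0,T)}\ \int_{t_0}^T \mathcal{L}(z(s),a(s))\,ds+J(z(T)),\qquad \frac{dz}{dt}(t)=a(t),\quad z(t_0)=z_0,$$ and assume that an optimal control $a^*$ exists and is unique; let $z^*$ be the associated optimal trajectory. (i) If $u_0<0$, let $\omega\in\mathbb{R}$ satisfy $\omega^2=-u_0/K$. Then $$S(t_0,z_0,T,z_T)=\frac{K\omega}{2\sinh(\omega(T-t_0))}\Big((\|z_0\|^2+\|z_T\|^2)\cosh(\omega(T-t_0))-2\,z_0\cdot z_T\Big)+J(z_T),$$ and for all $t\in[t_0,T]$, $$z^*(t)=\frac{z_T\sinh(\omega(t-t_0))+z_0\sinh(\omega(T-t))}{\sinh(\omega(T-t_0))},$$ $$a^*(t)=\omega\,\frac{z_T\cosh(\omega(t-t_0))-z_0\cosh(\omega(T-t))}{\sinh(\omega(T-t_0))}.$$ (ii) If $u_0>0$, let $\omega\in\mathbb{R}$ satisfy $\omega^2=u_0/K$. Then $$S(t_0,z_0,T,z_T)=\frac{K\omega}{2\sin(\omega(T-t_0))}\Big((\|z_0\|^2+\|z_T\|^2)\cos(\omega(T-t_0))-2\,z_0\cdot z_T\Big)+J(z_T),$$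 and for all $t\in[t_0,T]$, $$z^*(t)=\frac{z_T\sin(\omega(t-t_0))+z_0\sin(\omega(T-t))}{\sin(\omega(T-t_0))},$$ $$a^*(t)=\omega\,\frac{z_T\cos(\omega(t-t_0))-z_0\cos(\omega(T-t))}{\sin(\omega(T-t_0))}.$$
   Context: $\|\cdot\|$ and $\cdot$ denote the Euclidean norm and inner product on $\mathbb{R}^2$. $\Omega(t_0,T)$ is the space of absolutely continuous functions from $[t_0,T]$ to $\mathbb{R}^2$. The terminal cost is $J(z)=0$ if $z=z_T$ and $J(z)=+\infty$ otherwise (so the trajectory is constrained to satisfy $z(T)=z_T$, and $J(z_T)=0$). An optimal control is an element $a^*\in\Omega(t_0,T)$ attaining the minimum; the optimal trajectory is $z^*(t)=z_0+\int_{t_0}^t a^*(s)\,ds$. *)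

theory Defs
  imports "HOL-Analysis.Analysis"
begin

definition lagrangian :: "real \<Rightarrow> real \<Rightarrow> real ^ 2 \<Rightarrow> real ^ 2 \<Rightarrow> real" where
  "lagrangian K u0 z a = 1/2 * K * (norm a)\<^sup>2 - 1/2 * u0 * (norm z)\<^sup>2"

definition terminal_cost :: "real ^ 2 \<Rightarrow> real ^ 2 \<Rightarrow> ereal" where
  "terminal_cost zT z = (if z = zT then 0 else \<infinity>)"

text \<open>Absolute continuity of point functions; the library's \<open>absolutely_continuous\<close> concerns
  measures. The finite families of intervals are indexed by \<open>{..<n}\<close> and have
  pairwise disjoint interiors.\<close>

definition absolutely_continuous_fun ::
    "real \<Rightarrow> real \<Rightarrow> (real \<Rightarrow> 'a::real_normed_vector) \<Rightarrow> bool" where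
  "absolutely_continuous_fun t0 T f \<longleftrightarrow>
    (\<forall>\<epsilon>>0. \<exists>\<delta>>0. \<forall>(n::nat) l r.
       (\<forall>i<n. t0 \<le> l i \<and> l i \<le> r i \<and> r i \<le> T) \<longrightarrow>
       (\<forall>i<n. \<forall>j<n. i \<noteq> j \<longrightarrow> {l i<..<r i} \<inter> {l j<..<r j} = {}) \<longrightarrow>
       (\<Sum>i<n. r i - l i) < \<delta> \<longrightarrow>
       (\<Sum>i<n. norm (f (r i) - f (l i))) < \<epsilon>)"

text \<open>A function on \<open>[t0, T]\<close> is represented by any total function with these values on the
  interval, so equality of controls means equality on \<open>{t0..T}\<close>.\<close>

definition controls :: "real \<Rightarrow> real \<Rightarrow> (real \<Rightarrow> real ^ 2) set" where
  "controls t0 T = {a. absolutely_continuous_fun t0 T a}"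

definition trajectory :: "real \<Rightarrow> real ^ 2 \<Rightarrow> (real \<Rightarrow> real ^ 2) \<Rightarrow> real \<Rightarrow> real ^ 2" where
  "trajectory t0 z0 a t = z0 + integral {t0..t} a"

definition cost :: "real \<Rightarrow> real \<Rightarrow> real \<Rightarrow> real ^ 2 \<Rightarrow> real \<Rightarrow> real ^ 2 \<Rightarrow> (real \<Rightarrow> real ^ 2) \<Rightarrow> ereal" where
  "cost K u0 t0 z0 T zT a =
     ereal (integral {t0..T} (\<lambda>s. lagrangian K u0 (trajectory t0 z0 a s) (a s)))
       + terminal_cost zT (trajectory t0 z0 a T)"

text \<open>The infimum is a minimum exactly when an optimal control exists.\<close>

definition optimal_value :: "real \<Rightarrow> real \<Rightarrow> real \<Rightarrow> real ^ 2 \<Rightarrow> real \<Rightarrow> real ^ 2 \<Rightarrow> ereal" where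
  "optimal_value K u0 t0 z0 T zT = (INF a\<in>controls t0 T. cost K u0 t0 z0 T zT a)"

definition optimal_control ::
    "real \<Rightarrow> real \<Rightarrow> real \<Rightarrow> real ^ 2 \<Rightarrow> real \<Rightarrow> real ^ 2 \<Rightarrow> (real \<Rightarrow> real ^ 2) \<Rightarrow> bool" where
  "optimal_control K u0 t0 z0 T zT a \<longleftrightarrow>
     a \<in> controls t0 T \<and>
     (\<forall>b\<in>controls t0 T. cost K u0 t0 z0 T zT a \<le> cost K u0 t0 z0 T zT b)"

end

theory Submission
  imports Defs
begin

text \<open>
  The Lagrangian is a quadratic form, so the action obeys the parallelogram identity
  \<open>A(a + b) + A(a - b) = 2 A(a) + 2 A\<^sub>0(b)\<close>, where \<open>A\<^sub>0\<close> is the action for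
  the initial point \<open>0\<close>. Hence at an optimal control the second variation \<open>A\<^sub>0(b)\<close> is
  nonnegative for every \<open>b\<close> of integral \<open>0\<close>. For a solution of the Euler--Lagrange equation
  \<open>K z'' = - u0 z\<close> with the right end points the cross term is a boundary term that vanishes, so
  \<open>A(z' + b) = A(z') + A\<^sub>0(b)\<close>; such a solution is therefore optimal, and the uniqueness
  assumption identifies it with the given optimum. In the oscillatory case the uniqueness
  assumption also excludes \<open>sin (\<omega> (T - t0)) = 0\<close>: otherwise \<open>sin (\<omega> (t - t0))\<close> is a
  Jacobi field vanishing at both ends, along which the cost of the optimum does not change.
\<close>

section \<open>Absolutely continuous functions\<close>

text \<open>The source of admissible controls: the constant control of a straight line and the
  velocity of an extremal are both shown admissible through a Lipschitz bound.\<close>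

lemma absolutely_continuous_funI_lipschitz:
  fixes f :: "real \<Rightarrow> 'a::real_normed_vector"
  assumes lip: "\<And>x y. x \<in> {t0..T} \<Longrightarrow> y \<in> {t0..T} \<Longrightarrow> norm (f x - f y) \<le> B * \<bar>x - y\<bar>"
  shows "absolutely_continuous_fun t0 T f"
  unfolding absolutely_continuous_fun_def
proof (intro allI impI)
  fix \<epsilon> :: real
  assume "\<epsilon> > 0"
  \<comment> \<open>\<open>B\<close> may be zero or negative, so a positive upper bound replaces it
    before dividing by it.\<close>
  define C where "C = \<bar>B\<bar> + 1"
  have C: "C > 0" "B \<le> C" by (auto simp: C_def)
  show "\<exists>\<delta>>0. \<forall>(n::nat) l r.
       (\<forall>i<n. t0 \<le> l i \<and> l i \<le> r i \<and> r i \<le> T) \<longrightarrow>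
       (\<forall>i<n. \<forall>j<n. i \<noteq> j \<longrightarrow> {l i<..<r i} \<inter> {l j<..<r j} = {}) \<longrightarrow>
       (\<Sum>i<n. r i - l i) < \<delta> \<longrightarrow>
       (\<Sum>i<n. norm (f (r i) - f (l i))) < \<epsilon>"
  proof (intro exI[of _ "\<epsilon> / C"] conjI allI impI)
    show "\<epsilon> / C > 0" using \<open>\<epsilon> > 0\<close> C by simp
    fix n :: nat and l r :: "nat \<Rightarrow> real"
    assume lr: "\<forall>i<n. t0 \<le> l i \<and> l i \<le> r i \<and> r i \<le> T"
      and small: "(\<Sum>i<n. r i - l i) < \<epsilon> / C"
    have "(\<Sum>i<n. norm (f (r i) - f (l i))) \<le> (\<Sum>i<n. C * (r i - l i))"
    proof (rule sum_mono)
      fix i assume "i \<in> {..<n}"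
      with lr have i: "t0 \<le> l i" "l i \<le> r i" "r i \<le> T" by auto
      then have "norm (f (r i) - f (l i)) \<le> B * \<bar>r i - l i\<bar>" by (intro lip) auto
      also have "\<dots> \<le> C * (r i - l i)" using i C by (auto intro: mult_right_mono)
      finally show "norm (f (r i) - f (l i)) \<le> C * (r i - l i)" .
    qed
    also have "\<dots> = C * (\<Sum>i<n. r i - l i)" by (simp add: sum_distrib_left)
    also have "\<dots> < \<epsilon>" using small C by (simp add: field_simps)
    finally show "(\<Sum>i<n. norm (f (r i) - f (l i))) < \<epsilon>" .
  qed
qed

lemma absolutely_continuous_funE:
  assumes "absolutely_continuous_fun t0 T f" "\<epsilon> > 0"
  obtains \<delta> where "\<delta> > 0" "\<forall>(n::nat) l r.
       (\<forall>i<n. t0 \<le> l i \<and> l i \<le> r i \<and> r i \<le> T) \<longrightarrow>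
       (\<forall>i<n. \<forall>j<n. i \<noteq> j \<longrightarrow> {l i<..<r i} \<inter> {l j<..<r j} = {}) \<longrightarrow>
       (\<Sum>i<n. r i - l i) < \<delta> \<longrightarrow> (\<Sum>i<n. norm (f (r i) - f (l i))) < \<epsilon>"
  using assms(1)[unfolded absolutely_continuous_fun_def, THEN spec, THEN mp, OF assms(2)]
  by (elim exE conjE that)

text \<open>One interval between two nearby points is already an admissible family. Continuity then
  makes every integral below exist and lets the fundamental theorem of calculus hold at each
  point.\<close>

lemma absolutely_continuous_fun_imp_continuous_on:
  assumes "absolutely_continuous_fun t0 T f"
  shows "continuous_on {t0..T} f"
  unfolding continuous_on_iff
proof (intro ballI allI impI)
  fix x \<epsilon> :: real
  assume x: "x \<in> {t0..T}" and "\<epsilon> > 0"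
  obtain \<delta> where "\<delta> > 0" and \<delta>: "\<forall>(n::nat) l r.
       (\<forall>i<n. t0 \<le> l i \<and> l i \<le> r i \<and> r i \<le> T) \<longrightarrow>
       (\<forall>i<n. \<forall>j<n. i \<noteq> j \<longrightarrow> {l i<..<r i} \<inter> {l j<..<r j} = {}) \<longrightarrow>
       (\<Sum>i<n. r i - l i) < \<delta> \<longrightarrow> (\<Sum>i<n. norm (f (r i) - f (l i))) < \<epsilon>"
    by (rule absolutely_continuous_funE[OF assms \<open>\<epsilon> > 0\<close>])
  have "dist (f y) (f x) < \<epsilon>" if y: "y \<in> {t0..T}" and d: "dist y x < \<delta>" for y
  proof -
    have "norm (f (max x y) - f (min x y)) < \<epsilon>"
      using \<delta>[rule_format, of 1 "\<lambda>_. min x y" "\<lambda>_. max x y"] x y d by (auto simp: dist_real_def)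
    then show ?thesis
      by (auto simp: dist_norm max_def min_def norm_minus_commute split: if_splits)
  qed
  with \<open>\<delta> > 0\<close> show "\<exists>\<delta>>0. \<forall>y\<in>{t0..T}. dist y x < \<delta> \<longrightarrow> dist (f y) (f x) < \<epsilon>" by blast
qed

lemma absolutely_continuous_fun_add:
  assumes f: "absolutely_continuous_fun t0 T f" and g: "absolutely_continuous_fun t0 T g"
  shows "absolutely_continuous_fun t0 T (\<lambda>t. f t + g t)"
  unfolding absolutely_continuous_fun_def
proof (intro allI impI)
  fix \<epsilon> :: real
  assume "\<epsilon> > 0"
  then have e2: "\<epsilon> / 2 > 0" by simp
  obtain \<delta>1 where \<delta>1: "\<delta>1 > 0" "\<forall>(n::nat) l r.
       (\<forall>i<n. t0 \<le> l i \<and> l i \<le> r i \<and> r i \<le> T) \<longrightarrow>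
       (\<forall>i<n. \<forall>j<n. i \<noteq> j \<longrightarrow> {l i<..<r i} \<inter> {l j<..<r j} = {}) \<longrightarrow>
       (\<Sum>i<n. r i - l i) < \<delta>1 \<longrightarrow> (\<Sum>i<n. norm (f (r i) - f (l i))) < \<epsilon> / 2"
    by (rule absolutely_continuous_funE[OF f e2])
  obtain \<delta>2 where \<delta>2: "\<delta>2 > 0" "\<forall>(n::nat) l r.
       (\<forall>i<n. t0 \<le> l i \<and> l i \<le> r i \<and> r i \<le> T) \<longrightarrow>
       (\<forall>i<n. \<forall>j<n. i \<noteq> j \<longrightarrow> {l i<..<r i} \<inter> {l j<..<r j} = {}) \<longrightarrow>
       (\<Sum>i<n. r i - l i) < \<delta>2 \<longrightarrow> (\<Sum>i<n. norm (g (r i) - g (l i))) < \<epsilon> / 2"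
    by (rule absolutely_continuous_funE[OF g e2])
  show "\<exists>\<delta>>0. \<forall>(n::nat) l r.
       (\<forall>i<n. t0 \<le> l i \<and> l i \<le> r i \<and> r i \<le> T) \<longrightarrow>
       (\<forall>i<n. \<forall>j<n. i \<noteq> j \<longrightarrow> {l i<..<r i} \<inter> {l j<..<r j} = {}) \<longrightarrow>
       (\<Sum>i<n. r i - l i) < \<delta> \<longrightarrow>
       (\<Sum>i<n. norm (f (r i) + g (r i) - (f (l i) + g (l i)))) < \<epsilon>"
  proof (intro exI[of _ "min \<delta>1 \<delta>2"] conjI allI impI)
    show "min \<delta>1 \<delta>2 > 0" using \<delta>1 \<delta>2 by simp
    fix n :: nat and l r :: "nat \<Rightarrow> real"
    assume P: "\<forall>i<n. t0 \<le> l i \<and> l i \<le> r i \<and> r i \<le> T"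
        "\<forall>i<n. \<forall>j<n. i \<noteq> j \<longrightarrow> {l i<..<r i} \<inter> {l j<..<r j} = {}"
    assume small: "(\<Sum>i<n. r i - l i) < min \<delta>1 \<delta>2"
    have "(\<Sum>i<n. norm (f (r i) + g (r i) - (f (l i) + g (l i))))
        \<le> (\<Sum>i<n. norm (f (r i) - f (l i)) + norm (g (r i) - g (l i)))"
      by (intro sum_mono norm_diff_triangle_ineq)
    also have "\<dots> < \<epsilon>"
      using \<delta>1(2)[THEN spec, THEN spec, THEN spec, THEN mp, THEN mp, THEN mp, OF P]
        \<delta>2(2)[THEN spec, THEN spec, THEN spec, THEN mp, THEN mp, THEN mp, OF P] small
      by (simp add: sum.distrib)
    finally show "(\<Sum>i<n. norm (f (r i) + g (r i) - (f (l i) + g (l i)))) < \<epsilon>" .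
  qed
qed

lemma absolutely_continuous_fun_minus:
  assumes "absolutely_continuous_fun t0 T f"
  shows "absolutely_continuous_fun t0 T (\<lambda>t. - f t)"
proof -
  have "norm (- f x - - f y) = norm (f x - f y)" for x y
    by (metis minus_diff_eq minus_diff_minus norm_minus_cancel)
  with assms show ?thesis
    unfolding absolutely_continuous_fun_def by simp
qed

lemma absolutely_continuous_fun_diff:
  assumes "absolutely_continuous_fun t0 T f" "absolutely_continuous_fun t0 T g"
  shows "absolutely_continuous_fun t0 T (\<lambda>t. f t - g t)"
  using absolutely_continuous_fun_add[OF assms(1) absolutely_continuous_fun_minus[OF assms(2)]]
  by simp

section \<open>The action functional\<close>

text \<open>The finite part of the cost, kept real-valued so that identities may add and subtract
  it; the constraint on the right end point is handled separately.\<close>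

definition action :: "real \<Rightarrow> real \<Rightarrow> real \<Rightarrow> real \<Rightarrow> real ^ 2 \<Rightarrow> (real \<Rightarrow> real ^ 2) \<Rightarrow> real" where
  "action K u0 t0 T z0 a =
     integral {t0..T} (\<lambda>s. lagrangian K u0 (trajectory t0 z0 a s) (a s))"

lemma cost_eq_action:
  "cost K u0 t0 z0 T zT a =
     (if trajectory t0 z0 a T = zT then ereal (action K u0 t0 T z0 a) else \<infinity>)"
  by (simp add: cost_def action_def terminal_cost_def)

lemma lagrangian_parallelogram:
  "lagrangian K u0 (z + w) (a + b) + lagrangian K u0 (z - w) (a - b) =
     2 * (lagrangian K u0 z a + lagrangian K u0 w b)"
  unfolding lagrangian_def power2_norm_eq_inner
  by (simp add: inner_simps inner_commute algebra_simps)

text \<open>The last summand is the polar form of the quadratic form. Along an extremal it becomes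
  an exact derivative.\<close>

lemma lagrangian_add:
  "lagrangian K u0 (z + w) (a + b) =
     lagrangian K u0 z a + lagrangian K u0 w b + (K * (a \<bullet> b) - u0 * (z \<bullet> w))"
  unfolding lagrangian_def power2_norm_eq_inner
  by (simp add: inner_simps inner_commute algebra_simps)

section \<open>Controls, trajectories and the action on a fixed interval\<close>

context
  fixes t0 T :: real
begin

lemma controls_continuous_on: "a \<in> controls t0 T \<Longrightarrow> continuous_on {t0..T} a"
  by (simp add: controls_def absolutely_continuous_fun_imp_continuous_on)

lemma controls_add:
  "a \<in> controls t0 T \<Longrightarrow> b \<in> controls t0 T \<Longrightarrow> (\<lambda>t. a t + b t) \<in> controls t0 T"
  by (simp add: controls_def absolutely_continuous_fun_add)

lemma controls_diff:
  "a \<in> controls t0 T \<Longrightarrow> b \<in> controls t0 T \<Longrightarrow> (\<lambda>t. a t - b t) \<in> controls t0 T"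
  by (simp add: controls_def absolutely_continuous_fun_diff)

lemma control_integrable_on:
  assumes "a \<in> controls t0 T" "t \<in> {t0..T}"
  shows "a integrable_on {t0..t}"
proof -
  have "continuous_on {t0..t} a"
    using controls_continuous_on[OF assms(1)] by (rule continuous_on_subset) (use assms in auto)
  then show ?thesis by (rule integrable_continuous_real)
qed

lemma trajectory_add:
  assumes "a \<in> controls t0 T" "b \<in> controls t0 T" "t \<in> {t0..T}"
  shows "trajectory t0 (z + w) (\<lambda>s. a s + b s) t = trajectory t0 z a t + trajectory t0 w b t"
  using assms by (simp add: trajectory_def integral_add control_integrable_on)

lemma trajectory_diff:
  assumes "a \<in> controls t0 T" "b \<in> controls t0 T" "t \<in> {t0..T}"
  shows "trajectory t0 (z - w) (\<lambda>s. a s - b s) t = trajectory t0 z a t - trajectory t0 w b t"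
  using assms by (simp add: trajectory_def integral_diff control_integrable_on)

lemma trajectory_has_vector_derivative:
  assumes "a \<in> controls t0 T" "t \<in> {t0..T}"
  shows "(trajectory t0 z a has_vector_derivative a t) (at t within {t0..T})"
proof -
  have "((\<lambda>t. z + integral {t0..t} a) has_vector_derivative 0 + a t) (at t within {t0..T})"
    by (intro has_vector_derivative_add has_vector_derivative_const
        integral_has_vector_derivative controls_continuous_on assms)
  then show ?thesis by (simp add: trajectory_def[abs_def])
qed

lemma trajectory_continuous_on:
  "a \<in> controls t0 T \<Longrightarrow> continuous_on {t0..T} (trajectory t0 z a)"
  by (auto simp: continuous_on_eq_continuous_within
      intro: has_vector_derivative_continuous trajectory_has_vector_derivative)

lemma lagrangian_integrable_on:
  assumes "a \<in> controls t0 T"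
  shows "(\<lambda>s. lagrangian K u0 (trajectory t0 z a s) (a s)) integrable_on {t0..T}"
  unfolding lagrangian_def
  by (intro integrable_continuous_real continuous_intros controls_continuous_on
      trajectory_continuous_on assms)

lemma action_parallelogram:
  assumes a: "a \<in> controls t0 T" and b: "b \<in> controls t0 T"
  shows "action K u0 t0 T z (\<lambda>s. a s + b s) + action K u0 t0 T z (\<lambda>s. a s - b s) =
    2 * (action K u0 t0 T z a + action K u0 t0 T 0 b)"
proof -
  let ?L = "\<lambda>z a s. lagrangian K u0 (trajectory t0 z a s) (a s)"
  have "action K u0 t0 T z (\<lambda>s. a s + b s) + action K u0 t0 T z (\<lambda>s. a s - b s) =
      integral {t0..T} (\<lambda>s. ?L z (\<lambda>s. a s + b s) s + ?L z (\<lambda>s. a s - b s) s)"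
    unfolding action_def
    by (intro integral_add[symmetric] lagrangian_integrable_on controls_add controls_diff a b)
  also have "\<dots> = integral {t0..T} (\<lambda>s. 2 * (?L z a s + ?L 0 b s))"
  proof (rule integral_cong)
    fix s assume s: "s \<in> {t0..T}"
    show "?L z (\<lambda>s. a s + b s) s + ?L z (\<lambda>s. a s - b s) s = 2 * (?L z a s + ?L 0 b s)"
      \<comment> \<open>The initial point splits as \<open>z + 0\<close> and \<open>z - 0\<close>,
        so the perturbation starts at the origin.\<close>
      using trajectory_add[OF a b s, of z 0] trajectory_diff[OF a b s, of z 0]
      by (simp add: lagrangian_parallelogram)
  qed
  also have "\<dots> = 2 * (action K u0 t0 T z a + action K u0 t0 T 0 b)"
    unfolding action_def using a b by (simp add: integral_add lagrangian_integrable_on)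
  finally show ?thesis .
qed

section \<open>Extremals\<close>

text \<open>The Euler--Lagrange equation written as a first-order system, with one-sided derivatives
  at the ends. End points are left open, so that candidates for the optimum and Jacobi fields are
  covered alike.\<close>

definition extremal :: "real \<Rightarrow> real \<Rightarrow> (real \<Rightarrow> real ^ 2) \<Rightarrow> (real \<Rightarrow> real ^ 2) \<Rightarrow> bool" where
  "extremal K u0 z a \<longleftrightarrow> (\<forall>t\<in>{t0..T}.
     (z has_vector_derivative a t) (at t within {t0..T}) \<and>
     (a has_vector_derivative - (u0 / K) *\<^sub>R z t) (at t within {t0..T}))"

text \<open>The derivative of \<open>a\<close> is a multiple of the continuous \<open>z\<close>,
  hence bounded on the compact interval, so \<open>a\<close> is Lipschitz.\<close>

lemma extremal_in_controls:
  assumes "extremal K u0 z a"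
  shows "a \<in> controls t0 T"
proof -
  have "continuous_on {t0..T} z"
    using assms has_vector_derivative_continuous
    by (force simp: extremal_def continuous_on_eq_continuous_within)
  then have "continuous_on {t0..T} (\<lambda>t. - (u0 / K) *\<^sub>R z t)"
    by (intro continuous_intros)
  then have "bounded ((\<lambda>t. - (u0 / K) *\<^sub>R z t) ` {t0..T})"
    by (intro compact_imp_bounded compact_continuous_image) auto
  then obtain B where B: "\<And>t. t \<in> {t0..T} \<Longrightarrow> norm (- (u0 / K) *\<^sub>R z t) \<le> B"
    unfolding bounded_iff by blast
  have "norm (a x - a y) \<le> B * norm (x - y)" if "x \<in> {t0..T}" "y \<in> {t0..T}" for x y
  proof (rule differentiable_bound[OF convex_real_interval(5)])
    show "(a has_derivative (\<lambda>h. h *\<^sub>R (- (u0 / K) *\<^sub>R z t))) (at t within {t0..T})"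
      if "t \<in> {t0..T}" for t
      using assms that by (simp add: extremal_def has_vector_derivative_def)
    show "onorm (\<lambda>h. h *\<^sub>R (- (u0 / K) *\<^sub>R z t)) \<le> B" if "t \<in> {t0..T}" for t
      using B[OF that]
      by (intro onorm_le) (metis mult.commute mult_left_mono norm_ge_zero norm_scaleR real_norm_def)
  qed (use that in auto)
  then show ?thesis
    by (auto simp: controls_def intro!: absolutely_continuous_funI_lipschitz[where B = B])
qed

lemma trajectory_extremal:
  assumes "extremal K u0 z a" "t \<in> {t0..T}"
  shows "trajectory t0 (z t0) a t = z t"
proof -
  have "(a has_integral z t - z t0) {t0..t}"
  proof (rule fundamental_theorem_of_calculus)
    fix x assume "x \<in> {t0..t}"
    with assms have "(z has_vector_derivative a x) (at x within {t0..T})"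
      by (auto simp: extremal_def)
    then show "(z has_vector_derivative a x) (at x within {t0..t})"
      by (rule has_vector_derivative_within_subset) (use assms in auto)
  qed (use assms in auto)
  then show ?thesis by (simp add: trajectory_def integral_unique)
qed

text \<open>Along an extremal, \<open>K / 2 * (z t \<bullet> a t)\<close> is a primitive of the
  Lagrangian, because the equation turns \<open>z \<bullet> a'\<close> into the potential
  term.\<close>

lemma action_extremal:
  assumes ext: "extremal K u0 z a" and "K \<noteq> 0" "t0 \<le> T"
  shows "action K u0 t0 T (z t0) a = K / 2 * (z T \<bullet> a T - z t0 \<bullet> a t0)"
proof -
  have "((\<lambda>s. lagrangian K u0 (z s) (a s)) has_integral
      K / 2 * (z T \<bullet> a T) - K / 2 * (z t0 \<bullet> a t0)) {t0..T}"
  proof (rule fundamental_theorem_of_calculus)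
    fix t assume t: "t \<in> {t0..T}"
    have z: "(z has_vector_derivative a t) (at t within {t0..T})"
      and a: "(a has_vector_derivative - (u0 / K) *\<^sub>R z t) (at t within {t0..T})"
      using ext t by (auto simp: extremal_def)
    have "((\<lambda>t. K / 2 * (z t \<bullet> a t)) has_vector_derivative
        K / 2 * (z t \<bullet> (- (u0 / K) *\<^sub>R z t) + a t \<bullet> a t)) (at t within {t0..T})"
      by (intro has_vector_derivative_mult_right
          bounded_bilinear.has_vector_derivative[OF bounded_bilinear_inner] z a)
    also have "K / 2 * (z t \<bullet> (- (u0 / K) *\<^sub>R z t) + a t \<bullet> a t) = lagrangian K u0 (z t) (a t)"
      using \<open>K \<noteq> 0\<close> by (simp add: lagrangian_def power2_norm_eq_inner field_simps)
    finally show "((\<lambda>t. K / 2 * (z t \<bullet> a t)) has_vector_derivative lagrangian K u0 (z t) (a t))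
        (at t within {t0..T})" .
  qed (use assms in auto)
  moreover have "action K u0 t0 T (z t0) a = integral {t0..T} (\<lambda>s. lagrangian K u0 (z s) (a s))"
    unfolding action_def by (intro integral_cong) (simp add: trajectory_extremal[OF ext])
  ultimately show ?thesis by (simp add: integral_unique right_diff_distrib)
qed

text \<open>Integration by parts: the cross term is the derivative of
  \<open>K * (a t \<bullet> ?w t)\<close>, where \<open>?w\<close> is the trajectory of
  \<open>b\<close> from the origin, and \<open>?w\<close> vanishes at both ends.\<close>

lemma action_extremal_add:
  assumes ext: "extremal K u0 z a" and "K \<noteq> 0" "t0 \<le> T"
    and b: "b \<in> controls t0 T" "trajectory t0 0 b T = 0"
  shows "action K u0 t0 T (z t0) (\<lambda>s. a s + b s) =
    action K u0 t0 T (z t0) a + action K u0 t0 T 0 b"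
proof -
  let ?w = "trajectory t0 0 b"
  note a = extremal_in_controls[OF ext]
  have cross: "((\<lambda>s. K * (a s \<bullet> b s) - u0 * (z s \<bullet> ?w s)) has_integral
      K * (a T \<bullet> ?w T) - K * (a t0 \<bullet> ?w t0)) {t0..T}"
  proof (rule fundamental_theorem_of_calculus)
    fix t assume t: "t \<in> {t0..T}"
    have "((\<lambda>t. K * (a t \<bullet> ?w t)) has_vector_derivative
        K * (a t \<bullet> b t + (- (u0 / K) *\<^sub>R z t) \<bullet> ?w t)) (at t within {t0..T})"
      using ext t
      by (intro has_vector_derivative_mult_right trajectory_has_vector_derivative b
          bounded_bilinear.has_vector_derivative[OF bounded_bilinear_inner])
        (auto simp: extremal_def)
    also have "K * (a t \<bullet> b t + (- (u0 / K) *\<^sub>R z t) \<bullet> ?w t) = K * (a t \<bullet> b t) - u0 * (z t \<bullet> ?w t)"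
      using \<open>K \<noteq> 0\<close> by (simp add: field_simps)
    finally show "((\<lambda>t. K * (a t \<bullet> ?w t)) has_vector_derivative
        K * (a t \<bullet> b t) - u0 * (z t \<bullet> ?w t)) (at t within {t0..T})" .
  qed (use assms in auto)
  have cross0: "((\<lambda>s. K * (a s \<bullet> b s) - u0 * (z s \<bullet> ?w s)) has_integral 0) {t0..T}"
    using cross b(2) by (simp add: trajectory_def)
  let ?L = "\<lambda>z a s. lagrangian K u0 (trajectory t0 z a s) (a s)"
  have "action K u0 t0 T (z t0) (\<lambda>s. a s + b s) =
      integral {t0..T} (\<lambda>s. (?L (z t0) a s + ?L 0 b s) + (K * (a s \<bullet> b s) - u0 * (z s \<bullet> ?w s)))"
    unfolding action_def
  proof (rule integral_cong)
    fix s assume s: "s \<in> {t0..T}"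
    show "?L (z t0) (\<lambda>s. a s + b s) s =
        (?L (z t0) a s + ?L 0 b s) + (K * (a s \<bullet> b s) - u0 * (z s \<bullet> ?w s))"
      using trajectory_add[OF a b(1) s, of "z t0" 0] trajectory_extremal[OF ext s]
      by (simp add: lagrangian_add)
  qed
  also have "\<dots> = integral {t0..T} (\<lambda>s. ?L (z t0) a s + ?L 0 b s)"
    using cross0 a b(1)
    by (subst integral_add) (auto intro!: integrable_add lagrangian_integrable_on simp: integral_unique)
  also have "\<dots> = action K u0 t0 T (z t0) a + action K u0 t0 T 0 b"
    unfolding action_def using a b(1) by (simp add: integral_add lagrangian_integrable_on)
  finally show ?thesis .
qed

text \<open>\<open>S\<close> and \<open>C\<close> stand for \<open>sinh\<close> and
  \<open>cosh\<close> with \<open>k = 1\<close>, or \<open>sin\<close> and \<open>cos\<close> with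
  \<open>k = - 1\<close>. Two differentiations produce the factor
  \<open>k * \<omega>\<^sup>2\<close>, and the minus sign in \<open>T - t\<close> cancels the second
  time.\<close>

lemma extremal_fundamental_solution:
  fixes S C :: "real \<Rightarrow> real"
  assumes S: "\<And>x. (S has_field_derivative C x) (at x)"
    and C: "\<And>x. (C has_field_derivative k * S x) (at x)"
    and k: "k * \<omega>\<^sup>2 = - (u0 / K)"
  shows "extremal K u0
    (\<lambda>t. (S (\<omega> * (t - t0)) *\<^sub>R p + S (\<omega> * (T - t)) *\<^sub>R q) /\<^sub>R d)
    (\<lambda>t. \<omega> *\<^sub>R ((C (\<omega> * (t - t0)) *\<^sub>R p - C (\<omega> * (T - t)) *\<^sub>R q) /\<^sub>R d))"
  unfolding extremal_def
proof (intro ballI conjI)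
  fix t
  let ?F = "at t within {t0..T}"
  have dl: "((\<lambda>t. \<omega> * (t - t0)) has_field_derivative \<omega>) ?F"
    and dr: "((\<lambda>t. \<omega> * (T - t)) has_field_derivative - \<omega>) ?F"
    by (auto intro!: derivative_eq_intros)
  note d = DERIV_chain2[OF S dl] DERIV_chain2[OF S dr] DERIV_chain2[OF C dl] DERIV_chain2[OF C dr]
  \<comment> \<open>The zero summands are what the product rule gives for the constant vectors
    \<open>p\<close> and \<open>q\<close>.\<close>
  have "((\<lambda>t. (S (\<omega> * (t - t0)) *\<^sub>R p + S (\<omega> * (T - t)) *\<^sub>R q) /\<^sub>R d) has_vector_derivative
      ((S (\<omega> * (t - t0)) *\<^sub>R 0 + (C (\<omega> * (t - t0)) * \<omega>) *\<^sub>R p)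
        + (S (\<omega> * (T - t)) *\<^sub>R 0 + (C (\<omega> * (T - t)) * - \<omega>) *\<^sub>R q)) /\<^sub>R d) ?F"
    by (intro bounded_linear.has_vector_derivative[OF bounded_linear_scaleR_right]
        has_vector_derivative_add has_vector_derivative_scaleR has_vector_derivative_const d)
  then show "((\<lambda>t. (S (\<omega> * (t - t0)) *\<^sub>R p + S (\<omega> * (T - t)) *\<^sub>R q) /\<^sub>R d) has_vector_derivative
      \<omega> *\<^sub>R ((C (\<omega> * (t - t0)) *\<^sub>R p - C (\<omega> * (T - t)) *\<^sub>R q) /\<^sub>R d)) ?F"
    by (simp add: algebra_simps)
  have "((\<lambda>t. \<omega> *\<^sub>R ((C (\<omega> * (t - t0)) *\<^sub>R p - C (\<omega> * (T - t)) *\<^sub>R q) /\<^sub>R d)) has_vector_derivative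
      \<omega> *\<^sub>R (((C (\<omega> * (t - t0)) *\<^sub>R 0 + (k * S (\<omega> * (t - t0)) * \<omega>) *\<^sub>R p)
        - (C (\<omega> * (T - t)) *\<^sub>R 0 + (k * S (\<omega> * (T - t)) * - \<omega>) *\<^sub>R q)) /\<^sub>R d)) ?F"
    by (intro bounded_linear.has_vector_derivative[OF bounded_linear_scaleR_right]
        has_vector_derivative_diff has_vector_derivative_scaleR has_vector_derivative_const d)
  then show "((\<lambda>t. \<omega> *\<^sub>R ((C (\<omega> * (t - t0)) *\<^sub>R p - C (\<omega> * (T - t)) *\<^sub>R q) /\<^sub>R d)) has_vector_derivative
      - (u0 / K) *\<^sub>R ((S (\<omega> * (t - t0)) *\<^sub>R p + S (\<omega> * (T - t)) *\<^sub>R q) /\<^sub>R d)) ?F"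
    unfolding k[symmetric] by (simp add: algebra_simps power2_eq_square)
qed

section \<open>Optimal controls\<close>

text \<open>Some control has finite cost, so an optimum cannot have infinite cost.\<close>

lemma optimal_control_reaches_target:
  assumes "optimal_control K u0 t0 z0 T zT a" "t0 < T"
  shows "trajectory t0 z0 a T = zT"
proof -
  \<comment> \<open>The constant velocity of the straight line from \<open>z0\<close> to
    \<open>zT\<close>.\<close>
  define c where "c = (\<lambda>_::real. (zT - z0) /\<^sub>R (T - t0))"
  have "absolutely_continuous_fun t0 T c"
    by (rule absolutely_continuous_funI_lipschitz[where B = 0]) (simp add: c_def)
  then have "c \<in> controls t0 T" by (simp add: controls_def)
  then have "cost K u0 t0 z0 T zT a \<le> cost K u0 t0 z0 T zT c"
    using assms by (simp add: optimal_control_def)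
  moreover have "trajectory t0 z0 c T = zT"
    using \<open>t0 < T\<close> by (simp add: trajectory_def c_def)
  ultimately show ?thesis by (auto simp: cost_eq_action split: if_splits)
qed

lemma optimal_control_action_le:
  assumes "optimal_control K u0 t0 z0 T zT a" "t0 < T" "b \<in> controls t0 T"
    "trajectory t0 z0 b T = zT"
  shows "action K u0 t0 T z0 a \<le> action K u0 t0 T z0 b"
proof -
  have "cost K u0 t0 z0 T zT a \<le> cost K u0 t0 z0 T zT b"
    using assms by (simp add: optimal_control_def)
  then show ?thesis
    using assms optimal_control_reaches_target[OF assms(1,2)] by (simp add: cost_eq_action)
qed

text \<open>The means of producing further optima, to which the uniqueness assumption can then be
  applied.\<close>

lemma optimal_controlI_action_le:
  assumes "optimal_control K u0 t0 z0 T zT a" "t0 < T" "b \<in> controls t0 T"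
    "trajectory t0 z0 b T = zT" "action K u0 t0 T z0 b \<le> action K u0 t0 T z0 a"
  shows "optimal_control K u0 t0 z0 T zT b"
proof -
  have "cost K u0 t0 z0 T zT b \<le> cost K u0 t0 z0 T zT a"
    using assms optimal_control_reaches_target[OF assms(1,2)] by (simp add: cost_eq_action)
  with assms show ?thesis by (meson optimal_control_def order_trans)
qed

lemma optimal_value_eq_action:
  assumes "optimal_control K u0 t0 z0 T zT a" "t0 < T"
  shows "optimal_value K u0 t0 z0 T zT = ereal (action K u0 t0 T z0 a)"
proof -
  have "optimal_value K u0 t0 z0 T zT = cost K u0 t0 z0 T zT a"
    using assms unfolding optimal_value_def
    by (intro antisym INF_lower INF_greatest) (auto simp: optimal_control_def)
  then show ?thesis
    using optimal_control_reaches_target[OF assms] by (simp add: cost_eq_action)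
qed

section \<open>Variations of an optimal control\<close>

context
  fixes K u0 :: real and z0 zT :: "real ^ 2" and a :: "real \<Rightarrow> real ^ 2"
  assumes less: "t0 < T" and opt: "optimal_control K u0 t0 z0 T zT a"
begin

lemma optimal_control_perturbations:
  assumes b: "b \<in> controls t0 T" "trajectory t0 0 b T = 0"
  shows "action K u0 t0 T z0 a \<le> action K u0 t0 T z0 (\<lambda>s. a s + b s)"
    and "action K u0 t0 T z0 a \<le> action K u0 t0 T z0 (\<lambda>s. a s - b s)"
    and "trajectory t0 z0 (\<lambda>s. a s + b s) T = zT"
proof -
  have a: "a \<in> controls t0 T" using opt by (simp add: optimal_control_def)
  have T: "T \<in> {t0..T}" using less by simp
  note aT = optimal_control_reaches_target[OF opt less]
  show plus: "trajectory t0 z0 (\<lambda>s. a s + b s) T = zT"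
    using trajectory_add[OF a b(1) T, of z0 0] aT b(2) by simp
  have minus: "trajectory t0 z0 (\<lambda>s. a s - b s) T = zT"
    using trajectory_diff[OF a b(1) T, of z0 0] aT b(2) by simp
  show "action K u0 t0 T z0 a \<le> action K u0 t0 T z0 (\<lambda>s. a s + b s)"
    by (rule optimal_control_action_le[OF opt less controls_add[OF a b(1)] plus])
  show "action K u0 t0 T z0 a \<le> action K u0 t0 T z0 (\<lambda>s. a s - b s)"
    by (rule optimal_control_action_le[OF opt less controls_diff[OF a b(1)] minus])
qed

text \<open>Neither \<open>a + b\<close> nor \<open>a - b\<close> beats \<open>a\<close>, so the
  parallelogram identity leaves a nonnegative remainder.\<close>

lemma second_variation_nonneg:
  assumes b: "b \<in> controls t0 T" "trajectory t0 0 b T = 0"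
  shows "action K u0 t0 T 0 b \<ge> 0"
  using optimal_control_perturbations[OF b] action_parallelogram[OF _ b(1), of a K u0 z0] opt
  by (simp add: optimal_control_def)

text \<open>The actions of \<open>a + b\<close> and \<open>a - b\<close> now sum to twice that of
  \<open>a\<close>, and neither is smaller, so both equal it.\<close>

lemma optimal_control_add_null:
  assumes b: "b \<in> controls t0 T" "trajectory t0 0 b T = 0" and "action K u0 t0 T 0 b = 0"
  shows "optimal_control K u0 t0 z0 T zT (\<lambda>s. a s + b s)"
proof (rule optimal_controlI_action_le[OF opt less])
  have a: "a \<in> controls t0 T" using opt by (simp add: optimal_control_def)
  then show "(\<lambda>s. a s + b s) \<in> controls t0 T" using b by (intro controls_add)
  show "trajectory t0 z0 (\<lambda>s. a s + b s) T = zT" using optimal_control_perturbations[OF b] by simp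
  show "action K u0 t0 T z0 (\<lambda>s. a s + b s) \<le> action K u0 t0 T z0 a"
    using optimal_control_perturbations[OF b] action_parallelogram[OF a b(1), of K u0 z0]
      \<open>action K u0 t0 T 0 b = 0\<close> by simp
qed

text \<open>The extremal is compared with the given optimum only: for \<open>b = a - c\<close> the
  action of \<open>a\<close> exceeds that of \<open>c\<close> by the second variation at
  \<open>b\<close>, which is nonnegative.\<close>

lemma extremal_optimal:
  assumes ext: "extremal K u0 z c" and "K \<noteq> 0" and ends: "z t0 = z0" "z T = zT"
  shows "optimal_control K u0 t0 z0 T zT c"
proof (rule optimal_controlI_action_le[OF opt less])
  have a: "a \<in> controls t0 T" using opt by (simp add: optimal_control_def)
  have T: "T \<in> {t0..T}" using less by simp
  show c: "c \<in> controls t0 T" by (rule extremal_in_controls[OF ext])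
  show cT: "trajectory t0 z0 c T = zT" using trajectory_extremal[OF ext T] ends by simp
  define b where "b = (\<lambda>s. a s - c s)"
  have b: "b \<in> controls t0 T" unfolding b_def by (rule controls_diff[OF a c])
  have bT: "trajectory t0 0 b T = 0"
    using trajectory_diff[OF a c T, of z0 z0] cT optimal_control_reaches_target[OF opt less]
    by (simp add: b_def)
  show "action K u0 t0 T z0 c \<le> action K u0 t0 T z0 a"
    using action_extremal_add[OF ext \<open>K \<noteq> 0\<close> _ b bT] second_variation_nonneg[OF b bT] less
    by (simp add: ends b_def)
qed

section \<open>Consequences of uniqueness\<close>

context
  assumes unique: "\<And>b. optimal_control K u0 t0 z0 T zT b \<Longrightarrow> (\<forall>t\<in>{t0..T}. b t = a t)"
    and K: "K \<noteq> 0"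
begin

text \<open>The boundary formula gives such a field action zero, so adding its velocity to
  \<open>a\<close> yields another optimum, which must coincide with \<open>a\<close>.\<close>

lemma jacobi_field_zero:
  assumes ext: "extremal K u0 w b" and ends: "w t0 = 0" "w T = 0" and t: "t \<in> {t0..T}"
  shows "b t = 0"
proof -
  have "trajectory t0 0 b T = 0" "action K u0 t0 T 0 b = 0"
    using trajectory_extremal[OF ext, of T] action_extremal[OF ext K] less ends by auto
  then have "optimal_control K u0 t0 z0 T zT (\<lambda>s. a s + b s)"
    by (intro optimal_control_add_null extremal_in_controls[OF ext])
  then show ?thesis using unique t by fastforce
qed

lemma optimal_eq_extremal:
  assumes ext: "extremal K u0 z c" and ends: "z t0 = z0" "z T = zT"
  shows "optimal_value K u0 t0 z0 T zT = ereal (K / 2 * (zT \<bullet> c T - z0 \<bullet> c t0))"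
    and "t \<in> {t0..T} \<Longrightarrow> a t = c t"
    and "t \<in> {t0..T} \<Longrightarrow> trajectory t0 z0 a t = z t"
proof -
  note c = extremal_optimal[OF ext K ends]
  have eq: "c t = a t" if "t \<in> {t0..T}" for t using unique[OF c] that by blast
  show "optimal_value K u0 t0 z0 T zT = ereal (K / 2 * (zT \<bullet> c T - z0 \<bullet> c t0))"
    using optimal_value_eq_action[OF c less] action_extremal[OF ext K] less ends by simp
  assume t: "t \<in> {t0..T}"
  then show "a t = c t" using eq by simp
  have "integral {t0..t} a = integral {t0..t} c"
    using t by (intro integral_cong eq[symmetric]) auto
  then show "trajectory t0 z0 a t = z t"
    using trajectory_extremal[OF ext t] ends by (simp add: trajectory_def)
qed

section \<open>Hyperbolic and trigonometric solutions treated together\<close>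

context
  fixes S C :: "real \<Rightarrow> real" and k \<omega> :: real
  assumes S: "\<And>x. (S has_field_derivative C x) (at x)" "S 0 = 0"
    and C: "\<And>x. (C has_field_derivative k * S x) (at x)" "C 0 = 1"
    and k: "k * \<omega>\<^sup>2 = - (u0 / K)"
begin

text \<open>A zero here would make \<open>S (\<omega> * (t - t0))\<close> times a fixed vector a
  nontrivial Jacobi field. This justifies every later division by this value.\<close>

lemma no_conjugate_point:
  assumes "\<omega> \<noteq> 0"
  shows "S (\<omega> * (T - t0)) \<noteq> 0"
proof
  assume "S (\<omega> * (T - t0)) = 0"
  \<comment> \<open>The velocity at \<open>t0\<close> of the field with \<open>p\<close> the first
    basis vector, \<open>q = 0\<close> and \<open>d = 1\<close>; since \<open>C 0 = 1\<close>, it is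
    \<omega> times that vector.\<close>
  then have "\<omega> *\<^sub>R ((C (\<omega> * (t0 - t0)) *\<^sub>R axis 1 1 - C (\<omega> * (T - t0)) *\<^sub>R 0) /\<^sub>R 1) = (0 :: real ^ 2)"
    using less S(2)
    by (intro jacobi_field_zero[OF extremal_fundamental_solution[OF S(1) C(1) k]]) auto
  with \<open>\<omega> \<noteq> 0\<close> C(2) show False by (simp add: axis_eq_0_iff)
qed

text \<open>Dividing by \<open>S (\<omega> * (T - t0))\<close> makes the extremal interpolate
  \<open>z0\<close> and \<open>zT\<close>; the value is then its boundary term, expanded.\<close>

lemma optimal_eq_fundamental_solution:
  assumes "\<omega> \<noteq> 0"
  shows "optimal_value K u0 t0 z0 T zT =
      ereal (K * \<omega> / (2 * S (\<omega> * (T - t0))) *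
        (((norm z0)\<^sup>2 + (norm zT)\<^sup>2) * C (\<omega> * (T - t0)) - 2 * (z0 \<bullet> zT)))
        + terminal_cost zT zT" (is ?value)
    and "t \<in> {t0..T} \<Longrightarrow> trajectory t0 z0 a t =
      (S (\<omega> * (t - t0)) *\<^sub>R zT + S (\<omega> * (T - t)) *\<^sub>R z0) /\<^sub>R S (\<omega> * (T - t0))" (is "_ \<Longrightarrow> ?trajectory")
    and "t \<in> {t0..T} \<Longrightarrow> a t =
      \<omega> *\<^sub>R ((C (\<omega> * (t - t0)) *\<^sub>R zT - C (\<omega> * (T - t)) *\<^sub>R z0) /\<^sub>R S (\<omega> * (T - t0)))" (is "_ \<Longrightarrow> ?control")
proof -
  note s = no_conjugate_point[OF assms]
  note ext = extremal_fundamental_solution[OF S(1) C(1) k, where p = zT and q = z0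
      and d = "S (\<omega> * (T - t0))"]
  note eqs = optimal_eq_extremal[OF ext]
  show "t \<in> {t0..T} \<Longrightarrow> ?trajectory" "t \<in> {t0..T} \<Longrightarrow> ?control"
    using eqs(2,3)[of t] s S(2) by simp_all
  define s1 c1 where "s1 = S (\<omega> * (T - t0))" and "c1 = C (\<omega> * (T - t0))"
  have "optimal_value K u0 t0 z0 T zT =
      ereal (K / 2 * (zT \<bullet> (\<omega> *\<^sub>R ((c1 *\<^sub>R zT - z0) /\<^sub>R s1)) - z0 \<bullet> (\<omega> *\<^sub>R ((zT - c1 *\<^sub>R z0) /\<^sub>R s1))))"
    using eqs(1) s S(2) C(2) by (simp add: s1_def c1_def)
  also have "zT \<bullet> (\<omega> *\<^sub>R ((c1 *\<^sub>R zT - z0) /\<^sub>R s1)) - z0 \<bullet> (\<omega> *\<^sub>R ((zT - c1 *\<^sub>R z0) /\<^sub>R s1))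
      = \<omega> * inverse s1 * (((norm z0)\<^sup>2 + (norm zT)\<^sup>2) * c1 - 2 * (z0 \<bullet> zT))"
    by (simp add: power2_norm_eq_inner inner_diff_right inner_commute[of zT z0] algebra_simps)
  also have "K / 2 * (\<omega> * inverse s1 * (((norm z0)\<^sup>2 + (norm zT)\<^sup>2) * c1 - 2 * (z0 \<bullet> zT)))
      = K * \<omega> / (2 * s1) * (((norm z0)\<^sup>2 + (norm zT)\<^sup>2) * c1 - 2 * (z0 \<bullet> zT))"
    by (simp only: divide_inverse inverse_mult_distrib mult_ac)
  finally show ?value by (simp add: s1_def c1_def terminal_cost_def)
qed

end

end

end

end

section \<open>The two signs of the potential\<close>

theorem theorem1:
  fixes t0 T K u0 :: real
    and z0 zT :: "real ^ 2"
    and astar zstar :: "real \<Rightarrow> real ^ 2"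
  assumes "t0 < T" and "K > 0" and "u0 \<noteq> 0"
    and optimal: "optimal_control K u0 t0 z0 T zT astar"
    and unique: "\<And>b. optimal_control K u0 t0 z0 T zT b \<Longrightarrow> (\<forall>t\<in>{t0..T}. b t = astar t)"
    and zstar: "\<And>t. t \<in> {t0..T} \<Longrightarrow> zstar t = trajectory t0 z0 astar t"
  shows
    "(u0 < 0 \<longrightarrow> (\<forall>\<omega>::real. \<omega>\<^sup>2 = - u0 / K \<longrightarrow>
        optimal_value K u0 t0 z0 T zT =
          ereal (K * \<omega> / (2 * sinh (\<omega> * (T - t0))) *
            (((norm z0)\<^sup>2 + (norm zT)\<^sup>2) * cosh (\<omega> * (T - t0)) - 2 * (z0 \<bullet> zT)))
          + terminal_cost zT zT \<and>
        (\<forall>t\<in>{t0..T}.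
          zstar t = (sinh (\<omega> * (t - t0)) *\<^sub>R zT + sinh (\<omega> * (T - t)) *\<^sub>R z0)
                      /\<^sub>R sinh (\<omega> * (T - t0)) \<and>
          astar t = \<omega> *\<^sub>R ((cosh (\<omega> * (t - t0)) *\<^sub>R zT - cosh (\<omega> * (T - t)) *\<^sub>R z0)
                      /\<^sub>R sinh (\<omega> * (T - t0))))))
     \<and>
     (u0 > 0 \<longrightarrow> (\<forall>\<omega>::real. \<omega>\<^sup>2 = u0 / K \<longrightarrow>
        optimal_value K u0 t0 z0 T zT =
          ereal (K * \<omega> / (2 * sin (\<omega> * (T - t0))) *
            (((norm z0)\<^sup>2 + (norm zT)\<^sup>2) * cos (\<omega> * (T - t0)) - 2 * (z0 \<bullet> zT)))
          + terminal_cost zT zT \<and>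
        (\<forall>t\<in>{t0..T}.
          zstar t = (sin (\<omega> * (t - t0)) *\<^sub>R zT + sin (\<omega> * (T - t)) *\<^sub>R z0)
                      /\<^sub>R sin (\<omega> * (T - t0)) \<and>
          astar t = \<omega> *\<^sub>R ((cos (\<omega> * (t - t0)) *\<^sub>R zT - cos (\<omega> * (T - t)) *\<^sub>R z0)
                      /\<^sub>R sin (\<omega> * (T - t0))))))"
proof (intro conjI impI allI ballI)
  have K: "K \<noteq> 0" using \<open>K > 0\<close> by simp
  fix \<omega> :: real
  assume "u0 < 0" and \<omega>: "\<omega>\<^sup>2 = - u0 / K"
  \<comment> \<open>Here \<open>k = 1\<close>. Either square root may serve as \<omega>, as only its
    square and its being nonzero enter.\<close>
  then have "\<omega> \<noteq> 0" and k: "1 * \<omega>\<^sup>2 = - (u0 / K)" using K by auto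
  have deriv: "(sinh has_field_derivative cosh x) (at x)"
    "(cosh has_field_derivative 1 * sinh x) (at x)" for x :: real
    by (auto intro!: derivative_eq_intros)
  note eqs = optimal_eq_fundamental_solution
    [OF assms(1) optimal unique K deriv(1) _ deriv(2) _ k \<open>\<omega> \<noteq> 0\<close>]
  show "optimal_value K u0 t0 z0 T zT =
        ereal (K * \<omega> / (2 * sinh (\<omega> * (T - t0))) *
          (((norm z0)\<^sup>2 + (norm zT)\<^sup>2) * cosh (\<omega> * (T - t0)) - 2 * (z0 \<bullet> zT)))
        + terminal_cost zT zT"
    by (rule eqs(1)) auto
  fix t
  assume t: "t \<in> {t0..T}"
  show "zstar t = (sinh (\<omega> * (t - t0)) *\<^sub>R zT + sinh (\<omega> * (T - t)) *\<^sub>R z0)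
      /\<^sub>R sinh (\<omega> * (T - t0))"
    unfolding zstar[OF t] by (rule eqs(2)) (use t in auto)
  show "astar t = \<omega> *\<^sub>R ((cosh (\<omega> * (t - t0)) *\<^sub>R zT - cosh (\<omega> * (T - t)) *\<^sub>R z0)
      /\<^sub>R sinh (\<omega> * (T - t0)))"
    by (rule eqs(3)) (use t in auto)
next
  have K: "K \<noteq> 0" using \<open>K > 0\<close> by simp
  fix \<omega> :: real
  assume "u0 > 0" and \<omega>: "\<omega>\<^sup>2 = u0 / K"
  \<comment> \<open>The same argument with \<open>k = - 1\<close>; the sine in the denominator is
    nonzero by \<open>no_conjugate_point\<close>.\<close>
  then have "\<omega> \<noteq> 0" and k: "- 1 * \<omega>\<^sup>2 = - (u0 / K)" using K by auto
  have deriv: "(sin has_field_derivative cos x) (at x)"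
    "(cos has_field_derivative - 1 * sin x) (at x)" for x :: real
    by (auto intro!: derivative_eq_intros)
  note eqs = optimal_eq_fundamental_solution
    [OF assms(1) optimal unique K deriv(1) _ deriv(2) _ k \<open>\<omega> \<noteq> 0\<close>]
  show "optimal_value K u0 t0 z0 T zT =
        ereal (K * \<omega> / (2 * sin (\<omega> * (T - t0))) *
          (((norm z0)\<^sup>2 + (norm zT)\<^sup>2) * cos (\<omega> * (T - t0)) - 2 * (z0 \<bullet> zT)))
        + terminal_cost zT zT"
    by (rule eqs(1)) auto
  fix t
  assume t: "t \<in> {t0..T}"
  show "zstar t = (sin (\<omega> * (t - t0)) *\<^sub>R zT + sin (\<omega> * (T - t)) *\<^sub>R z0)
      /\<^sub>R sin (\<omega> * (T - t0))"
    unfolding zstar[OF t] by (rule eqs(2)) (use t in auto)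
  show "astar t = \<omega> *\<^sub>R ((cos (\<omega> * (t - t0)) *\<^sub>R zT - cos (\<omega> * (T - t)) *\<^sub>R z0)
      /\<^sub>R sin (\<omega> * (T - t0)))"
    by (rule eqs(3)) (use t in auto)
qed

end
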